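(* Let $\mathbf{P}$ be an additive category and let $\overline{\alpha}: (A \xrightarrow{\gamma_A} \Omega_A \xleftarrow{\rho_A} R_A) \to (B \xrightarrow{\gamma_B} \Omega_B \xleftarrow{\rho_B} R_B)$ be a morphism in $\mathcal{Q}(\mathbf{P})$. Then $$(A \xrightarrow{\gamma_A} \Omega_A \xleftarrow{\rho_A} R_A) \xrightarrow{\ \overline{\mathrm{id}_A}\ } (A \xrightarrow{\alpha\cdot\gamma_B} \Omega_B \xleftarrow{\rho_B} R_B) \xrightarrow{\ \overline{\alpha}\ } (B \xrightarrow{\gamma_B} \Omega_B \xleftarrow{\rho_B} R_B)$$ are well-defined morphisms in $\mathcal{Q}(\mathbf{P})$, the first an epimorphism and the second a monomorphism, whose composite is the given morphism $\overline{\alpha}$, and this is a universal epi-mono factorization: if $\overline{\tau_1}: (A \xrightarrow{\gamma_A} \Omega_A \xleftarrow{\rho_A} R_A) \to (T \xrightarrow{\gamma_T} \Omega_T \xleftarrow{\rho_T} R_T)$ is an epimorphism and $\overline{\tau_2}: (T \xrightarrow{\gamma_T} \Omega_T \xleftarrow{\rho_T} R_T) \to (B \xrightarrow{\gamma_B} \Omega_B \xleftarrow{\rho_B} R_B)$ is a monomorphism with $\overline{\tau_1}\cdot\overline{\tau_2} = \overline{\alpha}$, then $\tau_1: A \to T$ also defines a well-defined morphism $(A \xrightarrow{\alpha\cdot\gamma_B} \Omega_B \xleftarrow{\rho_B} R_B) \to (T \xrightarrow{\gamma_T} \Omega_T \xleftarrow{\rho_T} R_T)$ in $\mathcal{Q}(\mathbf{P})$,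 which is an isomorphism compatible with the two factorizations (its precomposition with $\overline{\mathrm{id}_A}$ is $\overline{\tau_1}$, and its postcomposition with $\overline{\tau_2}$ is the monomorphism $\overline{\alpha}: (A \xrightarrow{\alpha\cdot\gamma_B} \Omega_B \xleftarrow{\rho_B} R_B) \to (B \xrightarrow{\gamma_B} \Omega_B \xleftarrow{\rho_B} R_B)$).
   Context: Composition is written diagrammatically: for $\alpha: A \to B$ and $\beta: B \to C$, the composite is $\alpha\cdot\beta: A \to C$. A cospan in $\mathbf{P}$ is a pair of morphisms $(A \xrightarrow{\gamma} B \xleftarrow{\rho} C)$ with common codomain. $\mathrm{Syz}(A \xrightarrow{\gamma} B \xleftarrow{\rho} C)$ is the full subcategory of the slice category of $\mathbf{P}$ over $A$ whose objects, called syzygies, are the morphisms $\sigma: S \to A$ for which there exists $\omega: S \to C$ (a syzygy witness) with $\sigma\cdot\gamma = \omega\cdot\rho$. The additive category $\mathrm{Aux}(\mathbf{P})$ has as objects the cospans $(A \xrightarrow{\gamma_A} \Omega_A \xleftarrow{\rho_A} R_A)$ in $\mathbf{P}$; a morphism from $(A \xrightarrow{\gamma_A} \Omega_A \xleftarrow{\rho_A} R_A)$ to $(B \xrightarrow{\gamma_B} \Omega_B \xleftarrow{\rho_B} R_B)$ is a morphism $\alpha: A \to B$ in $\mathbf{P}$ satisfying the well-definedness property: $\sigma \in \mathrm{Syz}(A \xrightarrow{\gamma_A} \Omega_A \xleftarrow{\rho_A} R_A)$ implies $\sigma\cdot\alpha \in \mathrm{Syz}(B \xrightarrow{\gamma_B}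 \Omega_B \xleftarrow{\rho_B} R_B)$; composition and identities are those of $\mathbf{P}$. The ideal $\mathbf{I}(\mathbf{P})$ of $\mathrm{Aux}(\mathbf{P})$ consists of the morphisms $\alpha$ (notation as before) for which there exists $\zeta: A \to R_B$ with $\alpha\cdot\gamma_B = \zeta\cdot\rho_B$. $\mathcal{Q}(\mathbf{P}) := \mathrm{Aux}(\mathbf{P})/\mathbf{I}(\mathbf{P})$ is the additive quotient category; the class of a morphism $\alpha$ of $\mathrm{Aux}(\mathbf{P})$ is denoted $\overline{\alpha}$ (source and target being specified separately). *)

theory Defs
  imports "HOL-Algebra.Coset"
begin

section \<open>Categories\<close>

text \<open>
  A category is given by its family of hom-sets. The hom-sets are not required to be
  disjoint, so composition takes the three objects involved as arguments; it is written in
  diagrammatic order: for \<open>f \<in> Hom C X Y\<close> and \<open>g \<in> Hom C Y Z\<close>, the composite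
  "first \<open>f\<close>, then \<open>g\<close>" is \<open>Cmp C X Y Z f g\<close>.
\<close>

record ('o, 'm) category =
  Ob :: "'o set"
  Hom :: "'o \<Rightarrow> 'o \<Rightarrow> 'm set"
  Cmp :: "'o \<Rightarrow> 'o \<Rightarrow> 'o \<Rightarrow> 'm \<Rightarrow> 'm \<Rightarrow> 'm"
  Idt :: "'o \<Rightarrow> 'm"

locale category =
  fixes C :: "('o, 'm, 'x) category_scheme"
  assumes Idt_in_Hom: "X \<in> Ob C \<Longrightarrow> Idt C X \<in> Hom C X X"
    and Cmp_in_Hom: "\<lbrakk>X \<in> Ob C; Y \<in> Ob C; Z \<in> Ob C; f \<in> Hom C X Y; g \<in> Hom C Y Z\<rbrakk>
      \<Longrightarrow> Cmp C X Y Z f g \<in> Hom C X Z"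
    and Cmp_Idt_left: "\<lbrakk>X \<in> Ob C; Y \<in> Ob C; f \<in> Hom C X Y\<rbrakk> \<Longrightarrow> Cmp C X X Y (Idt C X) f = f"
    and Cmp_Idt_right: "\<lbrakk>X \<in> Ob C; Y \<in> Ob C; f \<in> Hom C X Y\<rbrakk> \<Longrightarrow> Cmp C X Y Y f (Idt C Y) = f"
    and Cmp_assoc: "\<lbrakk>W \<in> Ob C; X \<in> Ob C; Y \<in> Ob C; Z \<in> Ob C;
        f \<in> Hom C W X; g \<in> Hom C X Y; h \<in> Hom C Y Z\<rbrakk>
      \<Longrightarrow> Cmp C W Y Z (Cmp C W X Y f g) h = Cmp C W X Z f (Cmp C X Y Z g h)"

definition monomorphism :: "('o, 'm, 'x) category_scheme \<Rightarrow> 'o \<Rightarrow> 'o \<Rightarrow> 'm \<Rightarrow> bool" where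
  "monomorphism C X Y f \<longleftrightarrow> f \<in> Hom C X Y \<and>
     (\<forall>W \<in> Ob C. \<forall>g \<in> Hom C W X. \<forall>h \<in> Hom C W X.
        Cmp C W X Y g f = Cmp C W X Y h f \<longrightarrow> g = h)"

definition epimorphism :: "('o, 'm, 'x) category_scheme \<Rightarrow> 'o \<Rightarrow> 'o \<Rightarrow> 'm \<Rightarrow> bool" where
  "epimorphism C X Y f \<longleftrightarrow> f \<in> Hom C X Y \<and>
     (\<forall>Z \<in> Ob C. \<forall>g \<in> Hom C Y Z. \<forall>h \<in> Hom C Y Z.
        Cmp C X Y Z f g = Cmp C X Y Z f h \<longrightarrow> g = h)"

definition isomorphism :: "('o, 'm, 'x) category_scheme \<Rightarrow> 'o \<Rightarrow> 'o \<Rightarrow> 'm \<Rightarrow> bool" where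
  "isomorphism C X Y f \<longleftrightarrow> f \<in> Hom C X Y \<and>
     (\<exists>g \<in> Hom C Y X. Cmp C X Y X f g = Idt C X \<and> Cmp C Y X Y g f = Idt C Y)"

definition zero_object :: "('o, 'm, 'x) category_scheme \<Rightarrow> 'o \<Rightarrow> bool" where
  "zero_object C Z \<longleftrightarrow> Z \<in> Ob C \<and>
     (\<forall>X \<in> Ob C. (\<exists>!f. f \<in> Hom C X Z) \<and> (\<exists>!f. f \<in> Hom C Z X))"

definition full_subcategory :: "('o, 'm) category \<Rightarrow> 'o set \<Rightarrow> ('o, 'm) category" where
  "full_subcategory C U = C\<lparr>Ob := Ob C \<inter> U\<rparr>"

text \<open>An object of the slice category is recorded together with its source.\<close>

definition slice :: "('o, 'm, 'x) category_scheme \<Rightarrow> 'o \<Rightarrow> ('o \<times> 'm, 'm) category" where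
  "slice C A = \<lparr>
     Ob = {(S, \<sigma>). S \<in> Ob C \<and> \<sigma> \<in> Hom C S A},
     Hom = (\<lambda>(S, \<sigma>) (T, \<tau>). {f \<in> Hom C S T. Cmp C S T A f \<tau> = \<sigma>}),
     Cmp = (\<lambda>(S, \<sigma>) (T, \<tau>) (U, \<upsilon>). Cmp C S T U),
     Idt = (\<lambda>(S, \<sigma>). Idt C S)\<rparr>"


section \<open>Additive categories\<close>

record ('o, 'm) precategory = "('o, 'm) category" +
  Add :: "'o \<Rightarrow> 'o \<Rightarrow> 'm \<Rightarrow> 'm \<Rightarrow> 'm"
  Zer :: "'o \<Rightarrow> 'o \<Rightarrow> 'm"

text \<open>The abelian group of morphisms from \<open>X\<close> to \<open>Y\<close>; the group library writes it
  multiplicatively.\<close>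

definition hom_group :: "('o, 'm, 'x) precategory_scheme \<Rightarrow> 'o \<Rightarrow> 'o \<Rightarrow> 'm monoid" where
  "hom_group C X Y = \<lparr>carrier = Hom C X Y, mult = Add C X Y, one = Zer C X Y\<rparr>"

definition biproduct ::
  "('o, 'm, 'x) precategory_scheme \<Rightarrow> 'o \<Rightarrow> 'o \<Rightarrow> 'o \<Rightarrow> 'm \<Rightarrow> 'm \<Rightarrow> 'm \<Rightarrow> 'm \<Rightarrow> bool" where
  "biproduct C X Y D i j p q \<longleftrightarrow> D \<in> Ob C \<and>
     i \<in> Hom C X D \<and> j \<in> Hom C Y D \<and> p \<in> Hom C D X \<and> q \<in> Hom C D Y \<and>
     Cmp C X D X i p = Idt C X \<and> Cmp C Y D Y j q = Idt C Y \<and>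
     Cmp C X D Y i q = Zer C X Y \<and> Cmp C Y D X j p = Zer C Y X \<and>
     Add C D D (Cmp C D X D p i) (Cmp C D Y D q j) = Idt C D"

locale additive_category = category C
  for C :: "('o, 'm, 'x) precategory_scheme" +
  assumes hom_comm_group: "\<lbrakk>X \<in> Ob C; Y \<in> Ob C\<rbrakk> \<Longrightarrow> comm_group (hom_group C X Y)"
    and Cmp_Add_left: "\<lbrakk>X \<in> Ob C; Y \<in> Ob C; Z \<in> Ob C;
        f \<in> Hom C X Y; f' \<in> Hom C X Y; g \<in> Hom C Y Z\<rbrakk>
      \<Longrightarrow> Cmp C X Y Z (Add C X Y f f') g = Add C X Z (Cmp C X Y Z f g) (Cmp C X Y Z f' g)"
    and Cmp_Add_right: "\<lbrakk>X \<in> Ob C; Y \<in> Ob C; Z \<in> Ob C;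
        f \<in> Hom C X Y; g \<in> Hom C Y Z; g' \<in> Hom C Y Z\<rbrakk>
      \<Longrightarrow> Cmp C X Y Z f (Add C Y Z g g') = Add C X Z (Cmp C X Y Z f g) (Cmp C X Y Z f g')"
    and ex_zero_object: "\<exists>Z. zero_object C Z"
    and ex_biproduct: "\<lbrakk>X \<in> Ob C; Y \<in> Ob C\<rbrakk> \<Longrightarrow> \<exists>D i j p q. biproduct C X Y D i j p q"


section \<open>Quotients by ideals\<close>

text \<open>
  \<open>I X Y\<close> is meant to be the subgroup \<open>I(X, Y)\<close> of the hom-group from \<open>X\<close> to \<open>Y\<close>,
  for a two-sided ideal \<open>I\<close> of \<open>C\<close>.
\<close>

definition residue_class ::
  "('o, 'm, 'x) precategory_scheme \<Rightarrow> ('o \<Rightarrow> 'o \<Rightarrow> 'm set) \<Rightarrow> 'o \<Rightarrow> 'o \<Rightarrow> 'm \<Rightarrow> 'm set" where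
  "residue_class C I X Y f = I X Y #>\<^bsub>hom_group C X Y\<^esub> f"

text \<open>
  For an ideal, the class of \<open>f \<cdot> g\<close> does not depend on the representatives \<open>f\<close> of \<open>K\<close> and
  \<open>g\<close> of \<open>L\<close>, so the union in the composition below is the common value of these classes.
\<close>

definition quotient_category ::
  "('o, 'm, 'x) precategory_scheme \<Rightarrow> ('o \<Rightarrow> 'o \<Rightarrow> 'm set) \<Rightarrow> ('o, 'm set) precategory" where
  "quotient_category C I = \<lparr>
     Ob = Ob C,
     Hom = (\<lambda>X Y. carrier (hom_group C X Y Mod I X Y)),
     Cmp = (\<lambda>X Y Z K L. \<Union>f\<in>K. \<Union>g\<in>L. residue_class C I X Z (Cmp C X Y Z f g)),
     Idt = (\<lambda>X. residue_class C I X X (Idt C X)),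
     Add = (\<lambda>X Y. mult (hom_group C X Y Mod I X Y)),
     Zer = (\<lambda>X Y. one (hom_group C X Y Mod I X Y))\<rparr>"


section \<open>Cospans, syzygies, and the category \<open>\<Q>(P)\<close>\<close>

text \<open>\<open>\<lparr>src = A, mid = \<Omega>, rel = R, gam = \<gamma>, rho = \<rho>\<rparr>\<close> is the cospan \<open>A \<rightarrow> \<Omega> \<leftarrow> R\<close>
  with legs \<open>\<gamma>\<close> and \<open>\<rho>\<close>.\<close>

record ('o, 'm) cospan =
  src :: 'o
  mid :: 'o
  rel :: 'o
  gam :: 'm
  rho :: 'm

definition cospans :: "('o, 'm, 'x) category_scheme \<Rightarrow> ('o, 'm) cospan set" where
  "cospans P = {X. src X \<in> Ob P \<and> mid X \<in> Ob P \<and> rel X \<in> Ob P \<and>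
     gam X \<in> Hom P (src X) (mid X) \<and> rho X \<in> Hom P (rel X) (mid X)}"

definition Syz ::
  "('o, 'm, 'x) category_scheme \<Rightarrow> ('o, 'm) cospan \<Rightarrow> ('o \<times> 'm, 'm) category" where
  "Syz P X = full_subcategory (slice P (src X))
     {(S, \<sigma>). \<exists>\<omega> \<in> Hom P S (rel X).
        Cmp P S (src X) (mid X) \<sigma> (gam X) = Cmp P S (rel X) (mid X) \<omega> (rho X)}"

definition Aux ::
  "('o, 'm, 'x) precategory_scheme \<Rightarrow> (('o, 'm) cospan, 'm) precategory" where
  "Aux P = \<lparr>
     Ob = cospans P,
     Hom = (\<lambda>X Y. {\<alpha> \<in> Hom P (src X) (src Y).
        \<forall>(S, \<sigma>) \<in> Ob (Syz P X). (S, Cmp P S (src X) (src Y) \<sigma> \<alpha>) \<in> Ob (Syz P Y)}),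
     Cmp = (\<lambda>X Y Z. Cmp P (src X) (src Y) (src Z)),
     Idt = (\<lambda>X. Idt P (src X)),
     Add = (\<lambda>X Y. Add P (src X) (src Y)),
     Zer = (\<lambda>X Y. Zer P (src X) (src Y))\<rparr>"

definition Aux_ideal ::
  "('o, 'm, 'x) precategory_scheme \<Rightarrow> ('o, 'm) cospan \<Rightarrow> ('o, 'm) cospan \<Rightarrow> 'm set" where
  "Aux_ideal P X Y = {\<alpha> \<in> Hom (Aux P) X Y. \<exists>\<zeta> \<in> Hom P (src X) (rel Y).
     Cmp P (src X) (src Y) (mid Y) \<alpha> (gam Y) = Cmp P (src X) (rel Y) (mid Y) \<zeta> (rho Y)}"

definition QCat ::
  "('o, 'm, 'x) precategory_scheme \<Rightarrow> (('o, 'm) cospan, 'm set) precategory" where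
  "QCat P = quotient_category (Aux P) (Aux_ideal P)"

text \<open>\<open>Qcls P X Y \<alpha>\<close> is the class of \<open>\<alpha>\<close>, regarded as a morphism from \<open>X\<close> to \<open>Y\<close>.\<close>

abbreviation Qcls ::
  "('o, 'm, 'x) precategory_scheme \<Rightarrow> ('o, 'm) cospan \<Rightarrow> ('o, 'm) cospan \<Rightarrow> 'm \<Rightarrow> 'm set" where
  "Qcls P X Y \<alpha> \<equiv> residue_class (Aux P) (Aux_ideal P) X Y \<alpha>"

end

(*
  Write M for the middle cospan. A morphism f into A is a syzygy of M iff f \<alpha> is a syzygy of B;
  this makes \<alpha> : M -> B a monomorphism, and id : A -> M is an epimorphism because both cospans
  have the same source A.

  Given another factorization through T, the monomorphism \<tau>2 reflects syzygies, which makes \<tau>1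
  well-defined on M. The cokernel of the epimorphism \<tau>1 vanishes, and a witness for this contains
  a morphism u : T -> A with u \<tau>1 = id modulo syzygies. This u is the inverse of \<tau>1 : M -> T.
*)

theory Submission
  imports Defs
begin

context additive_category
begin

section \<open>Hom-groups and additivity of composition\<close>

lemma hom_group_simps [simp]:
  "carrier (hom_group C S T) = Hom C S T"
  "mult (hom_group C S T) = Add C S T"
  "one (hom_group C S T) = Zer C S T"
  by (simp_all add: hom_group_def)

lemma group_hom_group: "\<lbrakk>S \<in> Ob C; T \<in> Ob C\<rbrakk> \<Longrightarrow> group (hom_group C S T)"
  using hom_comm_group comm_group.axioms(2) by blast

text \<open>Bilinearity in the form of group homomorphisms, so that facts about units and inverses
  come from the group library.\<close>

lemma group_hom_Cmp_left:
  assumes "S \<in> Ob C" "T \<in> Ob C" "U \<in> Ob C" "f \<in> Hom C S T"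
  shows "group_hom (hom_group C T U) (hom_group C S U) (Cmp C S T U f)"
  using assms Cmp_Add_right[of S T U f] Cmp_in_Hom[of S T U f]
  by (auto intro!: group_hom.intro group_hom_group group_hom_axioms.intro homI)

lemma group_hom_Cmp_right:
  assumes "S \<in> Ob C" "T \<in> Ob C" "U \<in> Ob C" "g \<in> Hom C T U"
  shows "group_hom (hom_group C S T) (hom_group C S U) (\<lambda>f. Cmp C S T U f g)"
  using assms Cmp_Add_left[of S T U] Cmp_in_Hom[of S T U _ g]
  by (auto intro!: group_hom.intro group_hom_group group_hom_axioms.intro homI)

lemma Zer_in_Hom: "\<lbrakk>S \<in> Ob C; T \<in> Ob C\<rbrakk> \<Longrightarrow> Zer C S T \<in> Hom C S T"
  using group.is_monoid[OF group_hom_group, THEN monoid.one_closed] by simp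

lemma Add_Zer:
  assumes "S \<in> Ob C" "T \<in> Ob C" "f \<in> Hom C S T"
  shows "Add C S T f (Zer C S T) = f" "Add C S T (Zer C S T) f = f"
  using monoid.r_one[OF group.is_monoid[OF group_hom_group[OF assms(1,2)]], of f]
    monoid.l_one[OF group.is_monoid[OF group_hom_group[OF assms(1,2)]], of f] assms(3)
  by simp_all

lemma Cmp_Zer_right:
  "\<lbrakk>S \<in> Ob C; T \<in> Ob C; U \<in> Ob C; f \<in> Hom C S T\<rbrakk> \<Longrightarrow> Cmp C S T U f (Zer C T U) = Zer C S U"
  using group_hom.hom_one[OF group_hom_Cmp_left] by fastforce

lemma Cmp_Zer_left:
  "\<lbrakk>S \<in> Ob C; T \<in> Ob C; U \<in> Ob C; g \<in> Hom C T U\<rbrakk> \<Longrightarrow> Cmp C S T U (Zer C S T) g = Zer C S U"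
  using group_hom.hom_one[OF group_hom_Cmp_right] by fastforce

section \<open>Syzygies as subgroups of hom-groups\<close>

text \<open>The objects of \<open>Syz\<close> have varying sources; fixing the source
  \<open>S\<close> places the syzygies in a single hom-group, where subgroups and cosets make
  sense.\<close>

definition syzygies :: "'o \<Rightarrow> ('o, 'm) cospan \<Rightarrow> 'm set" where
  "syzygies S Y = {\<sigma>. (S, \<sigma>) \<in> Ob (Syz C Y)}"

lemma syzygies_iff:
  "\<sigma> \<in> syzygies S Y \<longleftrightarrow> S \<in> Ob C \<and> \<sigma> \<in> Hom C S (src Y) \<and>
     (\<exists>\<omega> \<in> Hom C S (rel Y).
        Cmp C S (src Y) (mid Y) \<sigma> (gam Y) = Cmp C S (rel Y) (mid Y) \<omega> (rho Y))"
  by (auto simp: syzygies_def Syz_def full_subcategory_def slice_def)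

lemma syzygiesD:
  assumes "\<sigma> \<in> syzygies S Y"
  shows "S \<in> Ob C" "\<sigma> \<in> Hom C S (src Y)"
  using assms by (auto simp: syzygies_iff)

lemma cospansD:
  assumes "Y \<in> cospans C"
  shows "src Y \<in> Ob C" "mid Y \<in> Ob C" "rel Y \<in> Ob C"
    "gam Y \<in> Hom C (src Y) (mid Y)" "rho Y \<in> Hom C (rel Y) (mid Y)"
  using assms by (auto simp: cospans_def)

text \<open>Composition with \<open>gam Y\<close> and with \<open>rho Y\<close> is additive, so
  witnesses add and invert along with the syzygies they belong to.\<close>

lemma subgroup_syzygies:
  assumes Y: "Y \<in> cospans C" and S: "S \<in> Ob C"
  shows "subgroup (syzygies S Y) (hom_group C S (src Y))"
proof -
  note D = cospansD[OF Y]
  interpret G: group_hom "hom_group C S (src Y)" "hom_group C S (mid Y)"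
      "\<lambda>f. Cmp C S (src Y) (mid Y) f (gam Y)"
    using S D by (intro group_hom_Cmp_right)
  interpret R: group_hom "hom_group C S (rel Y)" "hom_group C S (mid Y)"
      "\<lambda>f. Cmp C S (rel Y) (mid Y) f (rho Y)"
    using S D by (intro group_hom_Cmp_right)
  show ?thesis
  proof (rule G.G.subgroupI)
    show "syzygies S Y \<subseteq> carrier (hom_group C S (src Y))"
      by (auto simp: syzygies_iff)
    show "syzygies S Y \<noteq> {}"
      using S D Zer_in_Hom by (force simp: syzygies_iff Cmp_Zer_left)
  next
    fix f assume "f \<in> syzygies S Y"
    then obtain \<omega> where "f \<in> Hom C S (src Y)" "\<omega> \<in> Hom C S (rel Y)"
      "Cmp C S (src Y) (mid Y) f (gam Y) = Cmp C S (rel Y) (mid Y) \<omega> (rho Y)"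
      by (auto simp: syzygies_iff)
    then show "inv\<^bsub>hom_group C S (src Y)\<^esub> f \<in> syzygies S Y"
      using S G.hom_inv[of f] R.hom_inv[of \<omega>] G.G.inv_closed[of f] R.G.inv_closed[of \<omega>]
      by (auto simp: syzygies_iff intro!: bexI[of _ "inv\<^bsub>hom_group C S (rel Y)\<^esub> \<omega>"])
  next
    fix f g assume "f \<in> syzygies S Y" "g \<in> syzygies S Y"
    then obtain \<omega> \<upsilon> where "f \<in> Hom C S (src Y)" "\<omega> \<in> Hom C S (rel Y)"
      "Cmp C S (src Y) (mid Y) f (gam Y) = Cmp C S (rel Y) (mid Y) \<omega> (rho Y)"
      "g \<in> Hom C S (src Y)" "\<upsilon> \<in> Hom C S (rel Y)"
      "Cmp C S (src Y) (mid Y) g (gam Y) = Cmp C S (rel Y) (mid Y) \<upsilon> (rho Y)"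
      by (auto simp: syzygies_iff)
    then show "f \<otimes>\<^bsub>hom_group C S (src Y)\<^esub> g \<in> syzygies S Y"
      using S G.hom_mult[of f g] R.hom_mult[of \<omega> \<upsilon>] G.G.m_closed[of f g] R.G.m_closed[of \<omega> \<upsilon>]
      by (auto simp: syzygies_iff intro!: bexI[of _ "\<omega> \<otimes>\<^bsub>hom_group C S (rel Y)\<^esub> \<upsilon>"])
  qed
qed

text \<open>Precomposing a witness with \<open>h\<close> gives a witness for the composite.\<close>

lemma syzygies_Cmp_left:
  assumes Y: "Y \<in> cospans C" and "S \<in> Ob C" "h \<in> Hom C S T" "\<sigma> \<in> syzygies T Y"
  shows "Cmp C S T (src Y) h \<sigma> \<in> syzygies S Y"
proof -
  note D = cospansD[OF Y]
  obtain \<omega> where "T \<in> Ob C" "\<sigma> \<in> Hom C T (src Y)" "\<omega> \<in> Hom C T (rel Y)"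
      "Cmp C T (src Y) (mid Y) \<sigma> (gam Y) = Cmp C T (rel Y) (mid Y) \<omega> (rho Y)"
    using assms(4) by (auto simp: syzygies_iff)
  moreover from this have "Cmp C S (src Y) (mid Y) (Cmp C S T (src Y) h \<sigma>) (gam Y)
      = Cmp C S (rel Y) (mid Y) (Cmp C S T (rel Y) h \<omega>) (rho Y)"
    using assms D by (simp add: Cmp_assoc)
  ultimately show ?thesis
    using assms D by (auto simp: syzygies_iff intro: Cmp_in_Hom)
qed

section \<open>Well-defined morphisms and the ideal\<close>

lemma Hom_Aux_iff:
  "\<alpha> \<in> Hom (Aux C) X Y \<longleftrightarrow> \<alpha> \<in> Hom C (src X) (src Y) \<and>
     (\<forall>S. \<forall>\<sigma> \<in> syzygies S X. Cmp C S (src X) (src Y) \<sigma> \<alpha> \<in> syzygies S Y)"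
  by (auto simp: Aux_def syzygies_def)

lemma Hom_AuxD: "\<alpha> \<in> Hom (Aux C) X Y \<Longrightarrow> \<alpha> \<in> Hom C (src X) (src Y)"
  by (simp add: Hom_Aux_iff)

lemma syzygies_Cmp_right:
  "\<lbrakk>\<sigma> \<in> syzygies S X; \<alpha> \<in> Hom (Aux C) X Y\<rbrakk> \<Longrightarrow> Cmp C S (src X) (src Y) \<sigma> \<alpha> \<in> syzygies S Y"
  by (simp add: Hom_Aux_iff)

text \<open>The equation defining the ideal is the syzygy condition for a morphism out of
  \<open>src X\<close>. Such a morphism is automatically well-defined, because syzygies are stable
  under precomposition.\<close>

lemma Aux_ideal_eq_syzygies:
  assumes "X \<in> cospans C" "Y \<in> cospans C"
  shows "Aux_ideal C X Y = syzygies (src X) Y"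
proof -
  have "\<alpha> \<in> Hom (Aux C) X Y" if "\<alpha> \<in> syzygies (src X) Y" for \<alpha>
    using that assms syzygies_Cmp_left[OF assms(2)] by (auto simp: Hom_Aux_iff syzygies_iff)
  then show ?thesis
    using assms(1) by (auto simp: Aux_ideal_def syzygies_iff cospans_def dest: Hom_AuxD)
qed

section \<open>Classes modulo syzygies\<close>

text \<open>
  The class of a morphism of \<open>\<Q>(P)\<close> depends on its source cospan only through the object
  \<open>src X\<close>, so that classes make sense for arbitrary morphisms \<open>S \<rightarrow> src Y\<close> of the base category.
\<close>

definition syz_class :: "'o \<Rightarrow> ('o, 'm) cospan \<Rightarrow> 'm \<Rightarrow> 'm set" where
  "syz_class S Y f = syzygies S Y #>\<^bsub>hom_group C S (src Y)\<^esub> f"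

lemma Qcls_eq_syz_class:
  "\<lbrakk>X \<in> cospans C; Y \<in> cospans C\<rbrakk> \<Longrightarrow> Qcls C X Y f = syz_class (src X) Y f"
  by (simp add: residue_class_def syz_class_def Aux_ideal_eq_syzygies r_coset_def
      hom_group_def Aux_def)

lemma syz_class_self:
  "\<lbrakk>Y \<in> cospans C; S \<in> Ob C; f \<in> Hom C S (src Y)\<rbrakk> \<Longrightarrow> f \<in> syz_class S Y f"
  unfolding syz_class_def
  by (intro group.rcos_self group_hom_group subgroup_syzygies) (auto simp: cospans_def)

lemma syz_class_eq_iff_mem:
  assumes "Y \<in> cospans C" "S \<in> Ob C" "f \<in> Hom C S (src Y)"
  shows "g \<in> syz_class S Y f \<longleftrightarrow> g \<in> Hom C S (src Y) \<and> syz_class S Y g = syz_class S Y f"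
proof
  assume "g \<in> syz_class S Y f"
  moreover from this have "g \<in> Hom C S (src Y)"
    using assms monoid.r_coset_subset_G[OF group.is_monoid[OF group_hom_group] subgroup.subset[OF subgroup_syzygies]]
    by (fastforce simp: syz_class_def cospans_def)
  ultimately show "g \<in> Hom C S (src Y) \<and> syz_class S Y g = syz_class S Y f"
    using assms group.repr_independence[OF group_hom_group _ _ subgroup_syzygies]
    by (fastforce simp: syz_class_def cospans_def)
next
  assume "g \<in> Hom C S (src Y) \<and> syz_class S Y g = syz_class S Y f"
  then show "g \<in> syz_class S Y f"
    using assms syz_class_self by blast
qed

text \<open>In the multiplicative notation of the group library, the element on the right is the
  difference of \<open>f\<close> and \<open>g\<close>.\<close>

lemma syz_class_eq_iff:
  assumes "Y \<in> cospans C" "S \<in> Ob C" "f \<in> Hom C S (src Y)" "g \<in> Hom C S (src Y)"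
  shows "syz_class S Y f = syz_class S Y g \<longleftrightarrow>
    f \<otimes>\<^bsub>hom_group C S (src Y)\<^esub> inv\<^bsub>hom_group C S (src Y)\<^esub> g \<in> syzygies S Y"
proof -
  have "subgroup (syzygies S Y) (hom_group C S (src Y))"
    using assms by (intro subgroup_syzygies)
  then have "f \<in> syz_class S Y g \<longleftrightarrow>
      f \<otimes>\<^bsub>hom_group C S (src Y)\<^esub> inv\<^bsub>hom_group C S (src Y)\<^esub> g \<in> syzygies S Y"
    unfolding syz_class_def using assms cospansD
    by (intro subgroup.rcos_module) (auto intro: group_hom_group)
  then show ?thesis
    using syz_class_eq_iff_mem[OF assms(1,2,4)] assms(3) by simp
qed

lemma syz_class_eq_Zer_iff:
  assumes "Y \<in> cospans C" "S \<in> Ob C" "f \<in> Hom C S (src Y)"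
  shows "syz_class S Y f = syz_class S Y (Zer C S (src Y)) \<longleftrightarrow> f \<in> syzygies S Y"
proof -
  interpret group "hom_group C S (src Y)"
    using assms cospansD by (intro group_hom_group)
  show ?thesis
    using assms cospansD r_one[of f] inv_one Zer_in_Hom[of S "src Y"]
    by (subst syz_class_eq_iff) auto
qed

text \<open>A form without subtraction: \<open>\<omega>\<close> is a witness for the difference of
  \<open>f\<close> and \<open>g\<close>. It fits equations obtained by splitting along a
  biproduct.\<close>

lemma syz_class_eqI:
  assumes Y: "Y \<in> cospans C" and S: "S \<in> Ob C"
    and f: "f \<in> Hom C S (src Y)" and g: "g \<in> Hom C S (src Y)" and w: "\<omega> \<in> Hom C S (rel Y)"
    and eq: "Cmp C S (src Y) (mid Y) f (gam Y) = Add C S (mid Y)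
      (Cmp C S (rel Y) (mid Y) \<omega> (rho Y)) (Cmp C S (src Y) (mid Y) g (gam Y))"
  shows "syz_class S Y f = syz_class S Y g"
proof -
  note D = cospansD[OF Y]
  interpret G: group_hom "hom_group C S (src Y)" "hom_group C S (mid Y)"
      "\<lambda>f. Cmp C S (src Y) (mid Y) f (gam Y)"
    using S D by (intro group_hom_Cmp_right)
  let ?d = "f \<otimes>\<^bsub>hom_group C S (src Y)\<^esub> inv\<^bsub>hom_group C S (src Y)\<^esub> g"
  have "Cmp C S (rel Y) (mid Y) \<omega> (rho Y) \<in> Hom C S (mid Y)"
    using D S w by (intro Cmp_in_Hom)
  \<comment> \<open>This is \<open>eq\<close> solved for the difference, using additivity of
    composition with \<open>gam Y\<close>.\<close>
  then have "Cmp C S (src Y) (mid Y) ?d (gam Y) = Cmp C S (rel Y) (mid Y) \<omega> (rho Y)"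
    using f g eq G.hom_mult[of f "inv\<^bsub>hom_group C S (src Y)\<^esub> g"] G.hom_inv[of g]
      G.H.inv_solve_right[of "Cmp C S (rel Y) (mid Y) \<omega> (rho Y)"
        "Cmp C S (src Y) (mid Y) f (gam Y)" "Cmp C S (src Y) (mid Y) g (gam Y)"]
      G.G.inv_closed[of g] G.hom_closed[of g] G.hom_closed[of f] by simp
  moreover have "?d \<in> Hom C S (src Y)"
    using f g G.G.m_closed[of f] G.G.inv_closed[of g] by simp
  ultimately have "?d \<in> syzygies S Y"
    using S w unfolding syzygies_iff by blast
  then show ?thesis
    using syz_class_eq_iff[OF Y S f g] by simp
qed

text \<open>The morphism \<open>h\<close> may be any morphism of the base category, since
  precomposition preserves syzygies.\<close>

lemma syz_class_Cmp_left:
  assumes Y: "Y \<in> cospans C" and S: "S \<in> Ob C" and T: "T \<in> Ob C" and h: "h \<in> Hom C S T"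
    and f: "f \<in> Hom C T (src Y)" and g: "g \<in> Hom C T (src Y)"
    and eq: "syz_class T Y f = syz_class T Y g"
  shows "syz_class S Y (Cmp C S T (src Y) h f) = syz_class S Y (Cmp C S T (src Y) h g)"
proof -
  note D = cospansD[OF Y]
  interpret H: group_hom "hom_group C T (src Y)" "hom_group C S (src Y)" "Cmp C S T (src Y) h"
    using S T D h by (intro group_hom_Cmp_left)
  let ?i = "inv\<^bsub>hom_group C T (src Y)\<^esub> g"
  have "Cmp C S T (src Y) h (f \<otimes>\<^bsub>hom_group C T (src Y)\<^esub> ?i) \<in> syzygies S Y"
    using eq syz_class_eq_iff[OF Y T f g] by (intro syzygies_Cmp_left[OF Y S h]) simp
  then show ?thesis
    using f g H.hom_mult[of f ?i] H.hom_inv[of g] H.G.inv_closed[of g] H.hom_closed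
    by (subst syz_class_eq_iff[OF Y S]) auto
qed

text \<open>Pure additivity, with \<open>h\<close> only in the base category. It serves both for
  well-defined \<open>h\<close> and for comparing classes over the middle cospan of the
  factorization.\<close>

lemma syz_class_Cmp_right_iff:
  assumes Y: "Y \<in> cospans C" and Z: "Z \<in> cospans C" and S: "S \<in> Ob C"
    and h: "h \<in> Hom C (src Y) (src Z)"
    and f: "f \<in> Hom C S (src Y)" and g: "g \<in> Hom C S (src Y)"
  shows "syz_class S Z (Cmp C S (src Y) (src Z) f h) = syz_class S Z (Cmp C S (src Y) (src Z) g h)
    \<longleftrightarrow> Cmp C S (src Y) (src Z)
      (f \<otimes>\<^bsub>hom_group C S (src Y)\<^esub> inv\<^bsub>hom_group C S (src Y)\<^esub> g) h \<in> syzygies S Z"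
proof -
  interpret H: group_hom "hom_group C S (src Y)" "hom_group C S (src Z)"
      "\<lambda>f. Cmp C S (src Y) (src Z) f h"
    using S h cospansD[OF Y] cospansD[OF Z] by (intro group_hom_Cmp_right)
  show ?thesis
    using f g H.hom_mult[of f "inv\<^bsub>hom_group C S (src Y)\<^esub> g"] H.hom_inv[of g]
      H.G.inv_closed[of g] H.hom_closed
    by (subst syz_class_eq_iff[OF Z S]) auto
qed

text \<open>Well-definedness of \<open>h\<close>, applied to the difference of \<open>f\<close> and
  \<open>g\<close>, gives the condition in \<open>syz_class_Cmp_right_iff\<close>.\<close>

lemma syz_class_Cmp_right:
  assumes Y: "Y \<in> cospans C" and Z: "Z \<in> cospans C" and S: "S \<in> Ob C"
    and h: "h \<in> Hom (Aux C) Y Z"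
    and f: "f \<in> Hom C S (src Y)" and g: "g \<in> Hom C S (src Y)"
    and eq: "syz_class S Y f = syz_class S Y g"
  shows "syz_class S Z (Cmp C S (src Y) (src Z) f h) = syz_class S Z (Cmp C S (src Y) (src Z) g h)"
  using eq syzygies_Cmp_right[OF _ h] syz_class_eq_iff[OF Y S f g]
    syz_class_Cmp_right_iff[OF Y Z S Hom_AuxD[OF h] f g] by simp

section \<open>The quotient category in terms of representatives\<close>

lemma Ob_QCat: "Ob (QCat C) = cospans C"
  by (simp add: QCat_def quotient_category_def Aux_def)

lemma Hom_QCat:
  "\<lbrakk>X \<in> cospans C; Y \<in> cospans C\<rbrakk> \<Longrightarrow> Hom (QCat C) X Y = syz_class (src X) Y ` Hom (Aux C) X Y"
  using Qcls_eq_syz_class[of X Y]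
  by (auto simp: QCat_def quotient_category_def FactGroup_def RCOSETS_def residue_class_def
      hom_group_def)

lemma Idt_QCat: "X \<in> cospans C \<Longrightarrow> Idt (QCat C) X = syz_class (src X) X (Idt C (src X))"
  using Qcls_eq_syz_class[of X X] by (simp add: QCat_def quotient_category_def Aux_def)

text \<open>Changing first the right and then the left representative leaves the class of the
  composite fixed, so all members of the union defining composition agree.\<close>

lemma Cmp_QCat:
  assumes X: "X \<in> cospans C" and Y: "Y \<in> cospans C" and Z: "Z \<in> cospans C"
    and f: "f \<in> Hom (Aux C) X Y" and g: "g \<in> Hom (Aux C) Y Z"
  shows "Cmp (QCat C) X Y Z (syz_class (src X) Y f) (syz_class (src Y) Z g) =
    syz_class (src X) Z (Cmp C (src X) (src Y) (src Z) f g)"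
proof -
  note DX = cospansD[OF X] note DY = cospansD[OF Y]
  let ?c = "\<lambda>f g. syz_class (src X) Z (Cmp C (src X) (src Y) (src Z) f g)"
  have eq: "?c f' g' = ?c f g"
    if f': "f' \<in> syz_class (src X) Y f" and g': "g' \<in> syz_class (src Y) Z g" for f' g'
  proof -
    have 1: "f' \<in> Hom C (src X) (src Y)" "syz_class (src X) Y f' = syz_class (src X) Y f"
      using f' syz_class_eq_iff_mem[OF Y DX(1) Hom_AuxD[OF f]] by auto
    have 2: "g' \<in> Hom C (src Y) (src Z)" "syz_class (src Y) Z g' = syz_class (src Y) Z g"
      using g' syz_class_eq_iff_mem[OF Z DY(1) Hom_AuxD[OF g]] by auto
    have "?c f' g' = ?c f' g"
      using syz_class_Cmp_left[OF Z DX(1) DY(1) 1(1) 2(1) Hom_AuxD[OF g] 2(2)] .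
    also have "\<dots> = ?c f g"
      using syz_class_Cmp_right[OF Y Z DX(1) g 1(1) Hom_AuxD[OF f] 1(2)] .
    finally show ?thesis .
  qed
  \<comment> \<open>A constant union collapses to its value only over nonempty index sets.\<close>
  have "syz_class (src X) Y f \<noteq> {}" "syz_class (src Y) Z g \<noteq> {}"
    using syz_class_self[OF Y DX(1) Hom_AuxD[OF f]] syz_class_self[OF Z DY(1) Hom_AuxD[OF g]]
    by blast+
  have "Cmp (QCat C) X Y Z (syz_class (src X) Y f) (syz_class (src Y) Z g) =
      (\<Union>f'\<in>syz_class (src X) Y f. \<Union>g'\<in>syz_class (src Y) Z g. ?c f' g')"
    using Qcls_eq_syz_class[OF X Z] by (simp add: QCat_def quotient_category_def Aux_def)
  also have "\<dots> = (\<Union>f'\<in>syz_class (src X) Y f. \<Union>g'\<in>syz_class (src Y) Z g. ?c f g)"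
    by (intro SUP_cong refl eq)
  also have "\<dots> = ?c f g"
    using \<open>syz_class (src X) Y f \<noteq> {}\<close> \<open>syz_class (src Y) Z g \<noteq> {}\<close> by simp
  finally show ?thesis .
qed

text \<open>Every morphism of the quotient is the class of a well-defined one, so cancellation can
  be tested on representatives.\<close>

lemma monomorphism_QCat_iff:
  assumes X: "X \<in> cospans C" and Y: "Y \<in> cospans C" and f: "f \<in> Hom (Aux C) X Y"
  shows "monomorphism (QCat C) X Y (syz_class (src X) Y f) \<longleftrightarrow>
    (\<forall>W \<in> cospans C. \<forall>g \<in> Hom (Aux C) W X. \<forall>h \<in> Hom (Aux C) W X.
       syz_class (src W) Y (Cmp C (src W) (src X) (src Y) g f) =
       syz_class (src W) Y (Cmp C (src W) (src X) (src Y) h f) \<longrightarrow>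
       syz_class (src W) X g = syz_class (src W) X h)"
  using f by (simp add: monomorphism_def Ob_QCat Hom_QCat X Y Cmp_QCat cong: ball_cong)

lemma epimorphism_QCat_iff:
  assumes X: "X \<in> cospans C" and Y: "Y \<in> cospans C" and f: "f \<in> Hom (Aux C) X Y"
  shows "epimorphism (QCat C) X Y (syz_class (src X) Y f) \<longleftrightarrow>
    (\<forall>Z \<in> cospans C. \<forall>g \<in> Hom (Aux C) Y Z. \<forall>h \<in> Hom (Aux C) Y Z.
       syz_class (src X) Z (Cmp C (src X) (src Y) (src Z) f g) =
       syz_class (src X) Z (Cmp C (src X) (src Y) (src Z) f h) \<longrightarrow>
       syz_class (src Y) Z g = syz_class (src Y) Z h)"
  using f by (simp add: epimorphism_def Ob_QCat Hom_QCat X Y Cmp_QCat cong: ball_cong)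

lemma isomorphism_QCatI:
  assumes X: "X \<in> cospans C" and Y: "Y \<in> cospans C" and f: "f \<in> Hom (Aux C) X Y"
    and g: "g \<in> Hom (Aux C) Y X"
    and "syz_class (src X) X (Cmp C (src X) (src Y) (src X) f g) = syz_class (src X) X (Idt C (src X))"
    and "syz_class (src Y) Y (Cmp C (src Y) (src X) (src Y) g f) = syz_class (src Y) Y (Idt C (src Y))"
  shows "isomorphism (QCat C) X Y (syz_class (src X) Y f)"
  using assms by (auto simp: isomorphism_def Hom_QCat Idt_QCat Cmp_QCat intro!: bexI[where x=g])

section \<open>Consequences of being a monomorphism or an epimorphism\<close>

text \<open>
  A monomorphism \<open>\<tau>\<close> is tested against the cospan \<open>S \<rightarrow> S \<leftarrow> 0\<close> with left leg the identity:
  its only syzygies are zero, hence every morphism out of \<open>S\<close> is well-defined on it.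
\<close>

lemma mono_reflects_syzygies:
  assumes T: "T \<in> cospans C" and Y: "Y \<in> cospans C" and t: "\<tau> \<in> Hom (Aux C) T Y"
    and mono: "monomorphism (QCat C) T Y (syz_class (src T) Y \<tau>)"
    and S: "S \<in> Ob C" and s: "\<sigma> \<in> Hom C S (src T)"
    and syz: "Cmp C S (src T) (src Y) \<sigma> \<tau> \<in> syzygies S Y"
  shows "\<sigma> \<in> syzygies S T"
proof -
  note DT = cospansD[OF T] note DY = cospansD[OF Y]
  obtain N where N: "zero_object C N" using ex_zero_object by blast
  then have NOb: "N \<in> Ob C" by (simp add: zero_object_def)
  define W where "W = \<lparr>src = S, mid = S, rel = N, gam = Idt C S, rho = Zer C N S\<rparr>"
  have W: "W \<in> cospans C"
    using S NOb by (simp add: W_def cospans_def Idt_in_Hom Zer_in_Hom)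
  have srcW: "src W = S" by (simp add: W_def)
  \<comment> \<open>The left leg is the identity, so the witness equation equates
    \<open>\<upsilon>\<close> with a composite ending in the zero morphism
    \<open>rho W\<close>.\<close>
  have syzW: "\<upsilon> = Zer C U S" if "\<upsilon> \<in> syzygies U W" for U \<upsilon>
    using that S NOb by (auto simp: syzygies_iff W_def Cmp_Idt_right Cmp_Zer_right)
  have Hom_W: "f \<in> Hom (Aux C) W T" if f: "f \<in> Hom C S (src T)" for f
    unfolding Hom_Aux_iff srcW
  proof (intro conjI f allI ballI)
    fix U \<upsilon> assume \<upsilon>: "\<upsilon> \<in> syzygies U W"
    then have U: "U \<in> Ob C" by (simp add: syzygies_iff)
    show "Cmp C U S (src T) \<upsilon> f \<in> syzygies U T"
      using syzW[OF \<upsilon>] U S DT f subgroup.one_closed[OF subgroup_syzygies[OF T U]]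
      by (simp add: Cmp_Zer_left)
  qed
  have Z: "Zer C S (src T) \<in> Hom C S (src T)"
    using S DT by (intro Zer_in_Hom)
  \<comment> \<open>The monomorphism is cancelled against the pair \<open>\<sigma>\<close> and zero,
    both well-defined from \<open>W\<close> to \<open>T\<close> by \<open>Hom_W\<close>.\<close>
  have "syz_class S Y (Cmp C S (src T) (src Y) \<sigma> \<tau>) =
      syz_class S Y (Cmp C S (src T) (src Y) (Zer C S (src T)) \<tau>)"
    using syz S DT DY s Hom_AuxD[OF t]
    by (simp add: Cmp_Zer_left syz_class_eq_Zer_iff[OF Y S] Cmp_in_Hom)
  then have "syz_class S T \<sigma> = syz_class S T (Zer C S (src T))"
    using mono W Hom_W[OF s] Hom_W[OF Z] unfolding monomorphism_QCat_iff[OF T Y t]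
    by (metis srcW)
  then show ?thesis
    using syz_class_eq_Zer_iff[OF T S s] by simp
qed

text \<open>
  An epimorphism \<open>\<tau>\<close> is tested against the cospan \<open>T \<rightarrow> \<Omega>\<^sub>T \<leftarrow> R\<^sub>T \<oplus> src X\<close> with right leg
  \<open>(\<rho>\<^sub>T, \<tau>\<cdot>\<gamma>\<^sub>T)\<close>, a cokernel of \<open>\<tau>\<close>; the identity of \<open>T\<close> vanishes there, and a witness for
  this has the section as its component in \<open>src X\<close>.
\<close>

lemma epi_has_section:
  assumes X: "X \<in> cospans C" and T: "T \<in> cospans C" and t: "\<tau> \<in> Hom (Aux C) X T"
    and epi: "epimorphism (QCat C) X T (syz_class (src X) T \<tau>)"
  obtains u where "u \<in> Hom C (src T) (src X)"
    "syz_class (src T) T (Cmp C (src T) (src X) (src T) u \<tau>) = syz_class (src T) T (Idt C (src T))"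
proof -
  note DX = cospansD[OF X] note DT = cospansD[OF T]
  note tH = Hom_AuxD[OF t]
  obtain D i j p q where "biproduct C (rel T) (src X) D i j p q"
    using ex_biproduct[OF DT(3) DX(1)] by blast
  then have D: "D \<in> Ob C" and i: "i \<in> Hom C (rel T) D" and j: "j \<in> Hom C (src X) D"
    and p: "p \<in> Hom C D (rel T)" and q: "q \<in> Hom C D (src X)"
    and ip: "Cmp C (rel T) D (rel T) i p = Idt C (rel T)"
    and jq: "Cmp C (src X) D (src X) j q = Idt C (src X)"
    and iq: "Cmp C (rel T) D (src X) i q = Zer C (rel T) (src X)"
    and jp: "Cmp C (src X) D (rel T) j p = Zer C (src X) (rel T)"
    by (auto simp: biproduct_def)
  define c where "c = Cmp C (src X) (src T) (mid T) \<tau> (gam T)"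
  have c: "c \<in> Hom C (src X) (mid T)"
    using DX DT tH unfolding c_def by (intro Cmp_in_Hom)
  define r where "r = Add C D (mid T) (Cmp C D (rel T) (mid T) p (rho T)) (Cmp C D (src X) (mid T) q c)"
  have pr: "Cmp C D (rel T) (mid T) p (rho T) \<in> Hom C D (mid T)"
    and qc: "Cmp C D (src X) (mid T) q c \<in> Hom C D (mid T)"
    using D DT DX p q c by (auto intro: Cmp_in_Hom)
  interpret G: group "hom_group C D (mid T)" using D DT by (intro group_hom_group)
  have r: "r \<in> Hom C D (mid T)"
    using G.m_closed[of "Cmp C D (rel T) (mid T) p (rho T)" "Cmp C D (src X) (mid T) q c"] pr qc
    by (simp add: r_def)
  \<comment> \<open>A composite with \<open>r\<close> splits into the contributions of the two
    components of \<open>w\<close>; with \<open>w\<close> an injection this yields \<open>ir\<close>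
    and \<open>jr\<close>.\<close>
  have Cmp_r: "Cmp C S D (mid T) w r = Add C S (mid T)
      (Cmp C S (rel T) (mid T) (Cmp C S D (rel T) w p) (rho T))
      (Cmp C S (src X) (mid T) (Cmp C S D (src X) w q) c)"
    if "S \<in> Ob C" "w \<in> Hom C S D" for S w
    using that D DT DX p q c pr qc by (simp add: r_def Cmp_Add_right Cmp_assoc)
  have ir: "Cmp C (rel T) D (mid T) i r = rho T"
    using DT DX D i c by (simp add: Cmp_r ip iq Cmp_Idt_left Cmp_Zer_left Add_Zer)
  have jr: "Cmp C (src X) D (mid T) j r = c"
    using DT DX D j c by (simp add: Cmp_r jp jq Cmp_Idt_left Cmp_Zer_left Add_Zer)
  define Z where "Z = \<lparr>src = src T, mid = mid T, rel = D, gam = gam T, rho = r\<rparr>"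
  have Z_simps: "src Z = src T" "mid Z = mid T" "rel Z = D" "gam Z = gam T" "rho Z = r"
    by (simp_all add: Z_def)
  have Z: "Z \<in> cospans C"
    using DT D r by (simp add: cospans_def Z_simps)
  have IdT: "Idt C (src T) \<in> Hom C (src T) (src T)" using DT Idt_in_Hom by blast
  have id: "Idt C (src T) \<in> Hom (Aux C) T Z"
    unfolding Hom_Aux_iff Z_simps
  proof (intro conjI IdT allI ballI)
    fix S \<sigma> assume "\<sigma> \<in> syzygies S T"
    then obtain \<omega> where w: "S \<in> Ob C" "\<sigma> \<in> Hom C S (src T)" "\<omega> \<in> Hom C S (rel T)"
      "Cmp C S (src T) (mid T) \<sigma> (gam T) = Cmp C S (rel T) (mid T) \<omega> (rho T)"
      by (auto simp: syzygies_iff)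
    \<comment> \<open>A witness over \<open>rel T\<close> becomes one over \<open>D\<close> when
      followed by the injection \<open>i\<close>.\<close>
    have "Cmp C S D (mid T) (Cmp C S (rel T) D \<omega> i) r = Cmp C S (rel T) (mid T) \<omega> (rho T)"
      using w DT D i r ir by (simp add: Cmp_assoc)
    moreover have "Cmp C S (rel T) D \<omega> i \<in> Hom C S D"
      using w DT D i by (intro Cmp_in_Hom)
    ultimately show "Cmp C S (src T) (src T) \<sigma> (Idt C (src T)) \<in> syzygies S Z"
      using w DT by (auto simp: syzygies_iff Z_simps Cmp_Idt_right intro!: bexI)
  qed
  have zero_syz: "Zer C S (src T) \<in> syzygies S Z" if "S \<in> Ob C" for S
    using subgroup.one_closed[OF subgroup_syzygies[OF Z that]] by (simp add: Z_simps)
  have zero: "Zer C (src T) (src T) \<in> Hom (Aux C) T Z"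
    unfolding Hom_Aux_iff Z_simps
    using DT by (auto simp: Zer_in_Hom syzygies_iff[of _ _ T] Cmp_Zer_right zero_syz)
  \<comment> \<open>The injection \<open>j\<close> is the witness, by \<open>jr\<close>.\<close>
  have "\<tau> \<in> syzygies (src X) Z"
    using DX tH jr j by (auto simp: syzygies_iff Z_simps c_def intro!: bexI[where x=j])
  then have "syz_class (src X) Z \<tau> = syz_class (src X) Z (Zer C (src X) (src T))"
    using syz_class_eq_Zer_iff[OF Z DX(1), of \<tau>] tH by (simp add: Z_simps)
  \<comment> \<open>The epimorphism is cancelled from the identity and zero, both taken as morphisms
    from \<open>T\<close> to \<open>Z\<close>.\<close>
  then have "syz_class (src T) Z (Idt C (src T)) = syz_class (src T) Z (Zer C (src T) (src T))"
    using epi[unfolded epimorphism_QCat_iff[OF X T t], rule_format, OF Z id zero] DX DT tH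
    by (simp add: Z_simps Cmp_Idt_right Cmp_Zer_right)
  then have "Idt C (src T) \<in> syzygies (src T) Z"
    using syz_class_eq_Zer_iff[OF Z DT(1), of "Idt C (src T)"] IdT by (simp add: Z_simps)
  then obtain w where w: "w \<in> Hom C (src T) D"
    and weq: "gam T = Cmp C (src T) D (mid T) w r"
    using DT by (auto simp: syzygies_iff Z_simps Cmp_Idt_left)
  define u where "u = Cmp C (src T) D (src X) w q"
  have u: "u \<in> Hom C (src T) (src X)"
    unfolding u_def using w DT D DX q by (intro Cmp_in_Hom)
  have "syz_class (src T) T (Idt C (src T)) =
      syz_class (src T) T (Cmp C (src T) (src X) (src T) u \<tau>)"
  proof (rule syz_class_eqI[OF T DT(1) IdT])
    show "Cmp C (src T) (src X) (src T) u \<tau> \<in> Hom C (src T) (src T)"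
      using u tH DT DX by (intro Cmp_in_Hom)
    \<comment> \<open>The other component of \<open>w\<close>, in \<open>rel T\<close>, is the
      witness that \<open>u\<close> followed by \<open>\<tau>\<close> differs from the identity by a
      syzygy.\<close>
    show "Cmp C (src T) D (rel T) w p \<in> Hom C (src T) (rel T)"
      using w p DT D by (intro Cmp_in_Hom)
    show "Cmp C (src T) (src T) (mid T) (Idt C (src T)) (gam T) =
        Add C (src T) (mid T) (Cmp C (src T) (rel T) (mid T) (Cmp C (src T) D (rel T) w p) (rho T))
          (Cmp C (src T) (src T) (mid T) (Cmp C (src T) (src X) (src T) u \<tau>) (gam T))"
    proof -
      have "Cmp C (src T) (src T) (mid T) (Cmp C (src T) (src X) (src T) u \<tau>) (gam T) =
          Cmp C (src T) (src X) (mid T) u c"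
        using u tH DT DX by (simp add: Cmp_assoc c_def)
      moreover have "Cmp C (src T) (src T) (mid T) (Idt C (src T)) (gam T) = gam T"
        using DT by (simp add: Cmp_Idt_left)
      ultimately show ?thesis
        using trans[OF weq Cmp_r[OF DT(1) w]] unfolding u_def by argo
    qed
  qed
  then show ?thesis using that u by simp
qed

end

section \<open>The universal epi-mono factorization\<close>

theorem mainTheorem8:
  fixes P :: "('o, 'm, 'x) precategory_scheme"
    and X Y M :: "('o, 'm) cospan"
    and \<alpha> :: 'm
  assumes "additive_category P"
    and "X \<in> Ob (QCat P)" and "Y \<in> Ob (QCat P)"
    and "\<alpha> \<in> Hom (Aux P) X Y"
    and M_def: "M = \<lparr>src = src X, mid = mid Y, rel = rel Y,
          gam = Cmp P (src X) (src Y) (mid Y) \<alpha> (gam Y), rho = rho Y\<rparr>"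
  shows "M \<in> Ob (QCat P)
    \<and> Idt P (src X) \<in> Hom (Aux P) X M
    \<and> \<alpha> \<in> Hom (Aux P) M Y
    \<and> epimorphism (QCat P) X M (Qcls P X M (Idt P (src X)))
    \<and> monomorphism (QCat P) M Y (Qcls P M Y \<alpha>)
    \<and> Cmp (QCat P) X M Y (Qcls P X M (Idt P (src X))) (Qcls P M Y \<alpha>) = Qcls P X Y \<alpha>
    \<and> (\<forall>T \<in> Ob (QCat P). \<forall>\<tau>\<^sub>1 \<in> Hom (Aux P) X T. \<forall>\<tau>\<^sub>2 \<in> Hom (Aux P) T Y.
         epimorphism (QCat P) X T (Qcls P X T \<tau>\<^sub>1) \<longrightarrow>
         monomorphism (QCat P) T Y (Qcls P T Y \<tau>\<^sub>2) \<longrightarrow>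
         Cmp (QCat P) X T Y (Qcls P X T \<tau>\<^sub>1) (Qcls P T Y \<tau>\<^sub>2) = Qcls P X Y \<alpha> \<longrightarrow>
           \<tau>\<^sub>1 \<in> Hom (Aux P) M T
           \<and> isomorphism (QCat P) M T (Qcls P M T \<tau>\<^sub>1)
           \<and> Cmp (QCat P) X M T (Qcls P X M (Idt P (src X))) (Qcls P M T \<tau>\<^sub>1) = Qcls P X T \<tau>\<^sub>1
           \<and> Cmp (QCat P) M T Y (Qcls P M T \<tau>\<^sub>1) (Qcls P T Y \<tau>\<^sub>2) = Qcls P M Y \<alpha>)"
proof -
  interpret additive_category P by fact
  have X: "X \<in> cospans P" and Y: "Y \<in> cospans P" using assms(2,3) by (simp_all add: Ob_QCat)
  note DX = cospansD[OF X] and DY = cospansD[OF Y]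
  note \<alpha> = assms(4) and \<alpha>H = Hom_AuxD[OF assms(4)]
  have M_simps: "src M = src X" "mid M = mid Y" "rel M = rel Y"
    "gam M = Cmp P (src X) (src Y) (mid Y) \<alpha> (gam Y)" "rho M = rho Y"
    by (simp_all add: M_def)
  have M: "M \<in> cospans P"
    using DX DY \<alpha>H by (simp add: cospans_def M_simps Cmp_in_Hom)
  \<comment> \<open>By associativity the two witness equations coincide, since \<open>M\<close> and
    \<open>Y\<close> share their right leg.\<close>
  have syz_M: "\<sigma> \<in> syzygies S M \<longleftrightarrow> Cmp P S (src X) (src Y) \<sigma> \<alpha> \<in> syzygies S Y"
    if "S \<in> Ob P" "\<sigma> \<in> Hom P S (src X)" for S \<sigma>
    using that DX DY \<alpha>H by (simp add: syzygies_iff M_simps Cmp_assoc Cmp_in_Hom)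
  \<comment> \<open>This is \<open>syz_M\<close> applied to the difference of \<open>f\<close> and
    \<open>g\<close>; it contains the cancellation property of \<open>\<alpha>\<close> out of
    \<open>M\<close>.\<close>
  have cls_M: "syz_class S M f = syz_class S M g \<longleftrightarrow>
      syz_class S Y (Cmp P S (src X) (src Y) f \<alpha>) = syz_class S Y (Cmp P S (src X) (src Y) g \<alpha>)"
    if S: "S \<in> Ob P" and f: "f \<in> Hom P S (src X)" and g: "g \<in> Hom P S (src X)" for S f g
  proof -
    interpret G: group "hom_group P S (src X)" using S DX by (intro group_hom_group)
    have "f \<otimes>\<^bsub>hom_group P S (src X)\<^esub> inv\<^bsub>hom_group P S (src X)\<^esub> g \<in> Hom P S (src X)"
      using f g G.m_closed[of f] G.inv_closed[of g] by simp
    then show ?thesis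
      using syz_class_eq_iff[OF M S, of f g] f g
        syz_class_Cmp_right_iff[OF X Y S \<alpha>H f g] syz_M[OF S]
      by (simp add: M_simps)
  qed
  \<comment> \<open>By \<open>syz_M\<close> this amounts to \<open>\<alpha>\<close> preserving the
    syzygies of \<open>X\<close>.\<close>
  have id: "Idt P (src X) \<in> Hom (Aux P) X M"
    using DX Idt_in_Hom syzygies_Cmp_right[OF _ \<alpha>] syz_M
    by (auto simp: Hom_Aux_iff M_simps syzygies_iff[of _ _ X] Cmp_Idt_right)
  have \<alpha>M: "\<alpha> \<in> Hom (Aux P) M Y"
    using \<alpha>H syz_M syzygiesD[of _ _ M] by (fastforce simp: Hom_Aux_iff M_simps)
  have epi: "epimorphism (QCat P) X M (syz_class (src X) M (Idt P (src X)))"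
    unfolding epimorphism_QCat_iff[OF X M id]
  proof (intro ballI impI)
    fix Z g h
    assume Z: "Z \<in> cospans P" and "g \<in> Hom (Aux P) M Z" "h \<in> Hom (Aux P) M Z"
      and eq: "syz_class (src X) Z (Cmp P (src X) (src M) (src Z) (Idt P (src X)) g) =
        syz_class (src X) Z (Cmp P (src X) (src M) (src Z) (Idt P (src X)) h)"
    then have "g \<in> Hom P (src X) (src Z)" "h \<in> Hom P (src X) (src Z)"
      by (auto dest: Hom_AuxD simp: M_simps)
    \<comment> \<open>Since \<open>src M = src X\<close>, removing the identity from
      \<open>eq\<close> leaves exactly this equation.\<close>
    then show "syz_class (src M) Z g = syz_class (src M) Z h"
      using eq DX cospansD[OF Z] by (simp add: M_simps Cmp_Idt_left)
  qed
  have mono: "monomorphism (QCat P) M Y (syz_class (src M) Y \<alpha>)"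
    unfolding monomorphism_QCat_iff[OF M Y \<alpha>M]
    by (metis M_simps(1) Hom_AuxD cospansD(1) cls_M)
  have comp: "Cmp (QCat P) X M Y (syz_class (src X) M (Idt P (src X))) (syz_class (src M) Y \<alpha>) =
      syz_class (src X) Y \<alpha>"
    using Cmp_QCat[OF X M Y id \<alpha>M] DX DY \<alpha>H by (simp add: M_simps Cmp_Idt_left)
  have univ: "\<tau>\<^sub>1 \<in> Hom (Aux P) M T
      \<and> isomorphism (QCat P) M T (syz_class (src M) T \<tau>\<^sub>1)
      \<and> Cmp (QCat P) X M T (syz_class (src X) M (Idt P (src X))) (syz_class (src M) T \<tau>\<^sub>1) =
          syz_class (src X) T \<tau>\<^sub>1
      \<and> Cmp (QCat P) M T Y (syz_class (src M) T \<tau>\<^sub>1) (syz_class (src T) Y \<tau>\<^sub>2) =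
          syz_class (src M) Y \<alpha>"
    if T: "T \<in> cospans P" and t1: "\<tau>\<^sub>1 \<in> Hom (Aux P) X T" and t2: "\<tau>\<^sub>2 \<in> Hom (Aux P) T Y"
      and epi1: "epimorphism (QCat P) X T (syz_class (src X) T \<tau>\<^sub>1)"
      and mono2: "monomorphism (QCat P) T Y (syz_class (src T) Y \<tau>\<^sub>2)"
      and "Cmp (QCat P) X T Y (syz_class (src X) T \<tau>\<^sub>1) (syz_class (src T) Y \<tau>\<^sub>2) =
        syz_class (src X) Y \<alpha>"
    for T \<tau>\<^sub>1 \<tau>\<^sub>2
  proof -
    note DT = cospansD[OF T] and t1H = Hom_AuxD[OF t1] and t2H = Hom_AuxD[OF t2]
    let ?t = "Cmp P (src X) (src T) (src Y) \<tau>\<^sub>1 \<tau>\<^sub>2"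
    have tH: "?t \<in> Hom P (src X) (src Y)"
      using t1H t2H DX DT DY by (intro Cmp_in_Hom)
    have fact: "syz_class (src X) Y ?t = syz_class (src X) Y \<alpha>"
      using that(6) Cmp_QCat[OF X T Y t1 t2] by simp
    have fact_left: "syz_class S Y (Cmp P S (src T) (src Y) (Cmp P S (src X) (src T) f \<tau>\<^sub>1) \<tau>\<^sub>2) =
        syz_class S Y (Cmp P S (src X) (src Y) f \<alpha>)"
      if "S \<in> Ob P" "f \<in> Hom P S (src X)" for S f
      using syz_class_Cmp_left[OF Y that(1) DX(1) that(2) tH \<alpha>H fact] that DX DT DY t1H t2H
      by (simp add: Cmp_assoc)
    \<comment> \<open>By \<open>fact_left\<close> and \<open>syz_M\<close>, \<open>f\<close> is a
      syzygy of \<open>M\<close> iff \<open>f\<close> followed by \<open>\<tau>\<^sub>1\<close> and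
      \<open>\<tau>\<^sub>2\<close> is one of \<open>Y\<close>. The morphism
      \<open>\<tau>\<^sub>2\<close> preserves syzygies, and as a monomorphism it reflects
      them.\<close>
    have syz_fact: "Cmp P S (src X) (src T) f \<tau>\<^sub>1 \<in> syzygies S T \<Longrightarrow> f \<in> syzygies S M"
      and fact_syz: "f \<in> syzygies S M \<Longrightarrow> Cmp P S (src X) (src T) f \<tau>\<^sub>1 \<in> syzygies S T"
      if S: "S \<in> Ob P" and f: "f \<in> Hom P S (src X)" for S f
    proof -
      let ?f = "Cmp P S (src X) (src T) f \<tau>\<^sub>1"
      have fH: "?f \<in> Hom P S (src T)"
        using S f t1H DX DT by (intro Cmp_in_Hom)
      have "Cmp P S (src T) (src Y) ?f \<tau>\<^sub>2 \<in> Hom P S (src Y)"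
        "Cmp P S (src X) (src Y) f \<alpha> \<in> Hom P S (src Y)"
        using S f fH t2H \<alpha>H DX DT DY by (auto intro: Cmp_in_Hom)
      then have iff: "Cmp P S (src T) (src Y) ?f \<tau>\<^sub>2 \<in> syzygies S Y \<longleftrightarrow> f \<in> syzygies S M"
        using syz_class_eq_Zer_iff[OF Y S] fact_left[OF S f] syz_M[OF S f] by metis
      show "f \<in> syzygies S M" if "?f \<in> syzygies S T"
        using iff syzygies_Cmp_right[OF that t2] by simp
      show "?f \<in> syzygies S T" if "f \<in> syzygies S M"
        using iff that mono_reflects_syzygies[OF T Y t2 mono2 S fH] by simp
    qed
    have t1M: "\<tau>\<^sub>1 \<in> Hom (Aux P) M T"
      using t1H fact_syz syzygiesD[of _ _ M] by (fastforce simp: Hom_Aux_iff M_simps)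
    obtain u where u: "u \<in> Hom P (src T) (src X)"
      and sec: "syz_class (src T) T (Cmp P (src T) (src X) (src T) u \<tau>\<^sub>1) =
        syz_class (src T) T (Idt P (src T))"
      using epi_has_section[OF X T t1 epi1] .
    have ut: "Cmp P (src T) (src X) (src T) u \<tau>\<^sub>1 \<in> Hom P (src T) (src T)"
      using u t1H DX DT by (intro Cmp_in_Hom)
    \<comment> \<open>The section comes only as a base morphism. For a syzygy
      \<open>\<sigma>\<close> of \<open>T\<close>, following it by \<open>u\<close> and
      \<open>\<tau>\<^sub>1\<close> does not change its class, and \<open>syz_fact\<close> then
      removes \<open>\<tau>\<^sub>1\<close>.\<close>
    have uM: "u \<in> Hom (Aux P) T M"
      unfolding Hom_Aux_iff M_simps
    proof (intro conjI u allI ballI)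
      fix S \<sigma> assume \<sigma>: "\<sigma> \<in> syzygies S T"
      then have S: "S \<in> Ob P" and \<sigma>H: "\<sigma> \<in> Hom P S (src T)" by (auto simp: syzygies_iff)
      have su: "Cmp P S (src T) (src X) \<sigma> u \<in> Hom P S (src X)"
        using S \<sigma>H u DX DT by (intro Cmp_in_Hom)
      have sut: "Cmp P S (src X) (src T) (Cmp P S (src T) (src X) \<sigma> u) \<tau>\<^sub>1 \<in> Hom P S (src T)"
        using Cmp_in_Hom[OF S DX(1) DT(1) su t1H] .
      have "syz_class S T (Cmp P S (src X) (src T) (Cmp P S (src T) (src X) \<sigma> u) \<tau>\<^sub>1) = syz_class S T \<sigma>"
        using syz_class_Cmp_left[OF T S DT(1) \<sigma>H ut Idt_in_Hom[OF DT(1)] sec] S \<sigma>H u t1H DX DT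
        by (simp add: Cmp_assoc Cmp_Idt_right)
      then have "Cmp P S (src X) (src T) (Cmp P S (src T) (src X) \<sigma> u) \<tau>\<^sub>1 \<in> syzygies S T"
        using \<sigma> syz_class_eq_Zer_iff[OF T S] sut \<sigma>H by metis
      then show "Cmp P S (src T) (src X) \<sigma> u \<in> syzygies S M"
        by (rule syz_fact[OF S su])
    qed
    \<comment> \<open>The section property gives \<open>?v\<close> followed by
      \<open>\<tau>\<^sub>1\<close> the class of \<open>\<tau>\<^sub>1\<close>. Composing with
      \<open>\<tau>\<^sub>2\<close> turns \<open>\<tau>\<^sub>1\<close> into \<open>\<alpha>\<close>
      modulo syzygies, and \<open>cls_M\<close> cancels \<open>\<alpha>\<close>.\<close>
    have "syz_class (src X) M (Cmp P (src X) (src T) (src X) \<tau>\<^sub>1 u) =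
        syz_class (src X) M (Idt P (src X))"
    proof -
      let ?v = "Cmp P (src X) (src T) (src X) \<tau>\<^sub>1 u"
      have v: "?v \<in> Hom P (src X) (src X)"
        using t1H u DX DT by (intro Cmp_in_Hom)
      have v1: "Cmp P (src X) (src X) (src T) ?v \<tau>\<^sub>1 \<in> Hom P (src X) (src T)"
        using Cmp_in_Hom[OF DX(1) DX(1) DT(1) v t1H] .
      have "syz_class (src X) T (Cmp P (src X) (src X) (src T) ?v \<tau>\<^sub>1) = syz_class (src X) T \<tau>\<^sub>1"
        using syz_class_Cmp_left[OF T DX(1) DT(1) t1H ut Idt_in_Hom[OF DT(1)] sec] u t1H DX DT
        by (simp add: Cmp_assoc Cmp_Idt_right)
      from syz_class_Cmp_right[OF T Y DX(1) t2 v1 t1H this]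
      have "syz_class (src X) Y (Cmp P (src X) (src X) (src Y) ?v \<alpha>) = syz_class (src X) Y \<alpha>"
        using fact fact_left[OF DX(1) v] by simp
      then show ?thesis
        using cls_M[OF DX(1) v Idt_in_Hom[OF DX(1)]] DX DY \<alpha>H by (simp add: Cmp_Idt_left)
    qed
    then have "isomorphism (QCat P) M T (syz_class (src M) T \<tau>\<^sub>1)"
      using sec by (intro isomorphism_QCatI[OF M T t1M uM]) (simp_all add: M_simps)
    moreover have "Cmp (QCat P) X M T (syz_class (src X) M (Idt P (src X))) (syz_class (src M) T \<tau>\<^sub>1) =
        syz_class (src X) T \<tau>\<^sub>1"
      using Cmp_QCat[OF X M T id t1M] DX DT t1H by (simp add: M_simps Cmp_Idt_left)
    \<comment> \<open>Classes of morphisms into \<open>Y\<close> out of \<open>M\<close> and out of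
      \<open>X\<close> are the same sets, so \<open>fact\<close> carries over.\<close>
    moreover have "Cmp (QCat P) M T Y (syz_class (src M) T \<tau>\<^sub>1) (syz_class (src T) Y \<tau>\<^sub>2) =
        syz_class (src M) Y \<alpha>"
      using Cmp_QCat[OF M T Y t1M t2] fact by (simp add: M_simps)
    ultimately show ?thesis using t1M by simp
  qed
  show ?thesis
    using M id \<alpha>M epi mono comp univ
    by (simp add: Ob_QCat Qcls_eq_syz_class X Y)
qed

end
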